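(* Let $\lambda_0,\ldots,\lambda_{n-1}$ be nonempty subsets of $[d]=\{1,\ldots,d\}$, let $\Delta_{\lambda_i}=\operatorname{conv}\{e_j:j\in\lambda_i\}\subseteq\mathbb{R}^d$, and let $P=\sum_{i=0}^{n-1}\Delta_{\lambda_i}$ (Minkowski sum). For each $i$ let $F_i$ be a nonempty face of $\Delta_{\lambda_i}$, let $\Pi=(F_0,\ldots,F_{n-1})$ and $F=F_0+\cdots+F_{n-1}$. If the directed graph $G_\Pi$ is acyclic, then $F$ is a face of $P$, $\mathcal{N}(P)_F=\sigma_\Pi$, and $\dim(F)=d-|[d]/\sim_\Pi|$.
   Context: $e_1,\ldots,e_d$ is the standard basis of $\mathbb{R}^d$. For each $i$ let $V(F_i)=\{a\in[d]: e_a\text{ is a vertex of }F_i\}\subseteq\lambda_i$. The relation $\sim_\Pi$ is the smallest equivalence relation on $[d]$ such that $a\sim_\Pi b$ whenever $a,b\in V(F_i)$ for some $i$; $\bar a$ denotes the class of $a$. The digraph $G_\Pi$ has vertex set $[d]/\sim_\Pi$, with an edge $\bar b\to\bar a$ if and only if there is some $i$ with $\bar b\cap V(F_i)\ne\varnothing$ and $\bar a\cap(\lambda_i\setminus V(F_i))\ne\varnothing$. Loops are allowed and count as cycles. Let $a\sim_{Q_\Pi}b$ mean that $\bar a,\bar b$ lie in the same strongly connected component of $G_\Pi$, write $\hat a$ for the class of $a$ under $\sim_{Q_\Pi}$, and let $\preceq$ be the partial order on $[d]/\sim_{Q_\Pi}$ obtained as the transitive closure of: $\hat a\preceq\hat b$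 if $\bar a=\bar b$ or $\bar b\to\bar a$ is an edge of $G_\Pi$. The cone $\sigma_\Pi\subseteq\mathbb{R}^d/\mathbb{R}(1,\ldots,1)$ is the set of (classes of) $x$ with $x_a\le x_b$ for all $a,b\in[d]$ such that $\hat a\preceq\hat b$. The (outer) normal cone of a nonempty face $F$ of $P$ is $\mathcal{N}(P)_F=\{w: P_w\supseteq F\}$, where $P_w$ is the set of points of $P$ maximizing the linear functional $w\in\mathbb{R}^d$ (identified with $x\mapsto\sum_a w_ax_a$); it is regarded as a cone in $\mathbb{R}^d/\mathbb{R}(1,\ldots,1)$. *)

theory Defs
  imports "HOL-Analysis.Analysis"
begin

text \<open>
  The index set $[d]$ is a finite type \<open>'d\<close> with \<open>d = CARD('d)\<close>, so $R^d$ is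
  \<open>real ^ 'd\<close> and $e_a$ is \<open>axis a 1\<close>. The families $\lambda_i$ and $F_i$ are functions on
  \<open>nat\<close> of which only the values at \<open>i < n\<close> are used. Minkowski sums are the sums of
  sets from \<^theory>\<open>HOL-Library.Set_Algebras\<close>.
\<close>

definition std_simplex :: "'d::finite set \<Rightarrow> (real ^ 'd) set" where
  "std_simplex L = convex hull ((\<lambda>j. axis j 1) ` L)"

definition face_verts :: "(real ^ 'd::finite) set \<Rightarrow> 'd set" where
  "face_verts F = {a. axis a 1 extreme_point_of F}"


definition pi_rel :: "nat \<Rightarrow> (nat \<Rightarrow> (real ^ 'd::finite) set) \<Rightarrow> ('d \<times> 'd) set" where
  "pi_rel n F = {(a, b). equivclp (\<lambda>a b. \<exists>i<n. a \<in> face_verts (F i) \<and> b \<in> face_verts (F i)) a b}"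

definition pi_class :: "nat \<Rightarrow> (nat \<Rightarrow> (real ^ 'd::finite) set) \<Rightarrow> 'd \<Rightarrow> 'd set" where
  "pi_class n F a = pi_rel n F `` {a}"

text \<open>
  The vertices of $G_\Pi$ are the classes \<open>UNIV // pi_rel n F\<close>; there are no parallel edges, so
  the digraph is given by its edge relation, where \<open>(B, A)\<close> is the edge from \<open>B\<close> to \<open>A\<close>.
  Loops are allowed, and \<^const>\<open>acyclic\<close> excludes them.
\<close>

definition pi_graph ::
    "nat \<Rightarrow> (nat \<Rightarrow> 'd::finite set) \<Rightarrow> (nat \<Rightarrow> (real ^ 'd) set) \<Rightarrow> ('d set \<times> 'd set) set" where
  "pi_graph n lam F =
     {(B, A). B \<in> UNIV // pi_rel n F \<and> A \<in> UNIV // pi_rel n F \<and>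
        (\<exists>i<n. B \<inter> face_verts (F i) \<noteq> {} \<and> A \<inter> (lam i - face_verts (F i)) \<noteq> {})}"

definition q_rel ::
    "nat \<Rightarrow> (nat \<Rightarrow> 'd::finite set) \<Rightarrow> (nat \<Rightarrow> (real ^ 'd) set) \<Rightarrow> ('d \<times> 'd) set" where
  "q_rel n lam F =
     {(a, b). (pi_class n F a, pi_class n F b) \<in> (pi_graph n lam F)\<^sup>* \<and>
              (pi_class n F b, pi_class n F a) \<in> (pi_graph n lam F)\<^sup>*}"

definition q_class ::
    "nat \<Rightarrow> (nat \<Rightarrow> 'd::finite set) \<Rightarrow> (nat \<Rightarrow> (real ^ 'd) set) \<Rightarrow> 'd \<Rightarrow> 'd set" where
  "q_class n lam F a = q_rel n lam F `` {a}"

text \<open>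
  A relation on the quotient \<open>UNIV // q_rel n lam F\<close>. The order is opposite to the edges: an edge
  from the class of \<open>b\<close> to the class of \<open>a\<close> puts \<open>a\<close> below \<open>b\<close>.
\<close>

definition q_order ::
    "nat \<Rightarrow> (nat \<Rightarrow> 'd::finite set) \<Rightarrow> (nat \<Rightarrow> (real ^ 'd) set) \<Rightarrow> ('d set \<times> 'd set) set" where
  "q_order n lam F =
     {(q_class n lam F a, q_class n lam F b) | a b.
        pi_class n F a = pi_class n F b \<or>
        (pi_class n F b, pi_class n F a) \<in> pi_graph n lam F}\<^sup>+"


text \<open>
  Cones in $R^d / R(1, \ldots, 1)$ are sets of equivalence classes of the relation below. Both cones
  are images of subsets of \<open>real ^ 'd\<close> under the quotient map.
\<close>

definition ones_rel :: "((real ^ 'd::finite) \<times> (real ^ 'd)) set" where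
  "ones_rel = {(x, y). \<exists>c::real. y = x + (\<chi> a. c)}"

definition sigma_cone ::
    "nat \<Rightarrow> (nat \<Rightarrow> 'd::finite set) \<Rightarrow> (nat \<Rightarrow> (real ^ 'd) set) \<Rightarrow> (real ^ 'd) set set" where
  "sigma_cone n lam F =
     {x. \<forall>a b. (q_class n lam F a, q_class n lam F b) \<in> q_order n lam F \<longrightarrow> x $ a \<le> x $ b} // ones_rel"

definition max_face :: "(real ^ 'd::finite) set \<Rightarrow> real ^ 'd \<Rightarrow> (real ^ 'd) set" where
  "max_face P w = {x \<in> P. \<forall>y\<in>P. w \<bullet> y \<le> w \<bullet> x}"

definition outer_normal_cone ::
    "(real ^ 'd::finite) set \<Rightarrow> (real ^ 'd) set \<Rightarrow> (real ^ 'd) set set" where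
  "outer_normal_cone P F = {w. F \<subseteq> max_face P w} // ones_rel"


lemma equiv_pi_rel: "equiv UNIV (pi_rel n F)"
  unfolding pi_rel_def
  by (intro equivI refl_onI symI transI)
     (auto intro: equivclp_sym equivclp_trans)

text \<open>\<^const>\<open>pi_rel\<close> is the smallest equivalence relation identifying the vertices of each face.\<close>

lemma pi_rel_contains:
  "i < n \<Longrightarrow> a \<in> face_verts (F i) \<Longrightarrow> b \<in> face_verts (F i) \<Longrightarrow> (a, b) \<in> pi_rel n F"
  by (auto simp: pi_rel_def intro!: r_into_equivclp)

lemma pi_rel_least:
  assumes "equiv UNIV r"
    and "\<And>i a b. i < n \<Longrightarrow> a \<in> face_verts (F i) \<Longrightarrow> b \<in> face_verts (F i) \<Longrightarrow> (a, b) \<in> r"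
  shows "pi_rel n F \<subseteq> r"
proof clarify
  fix a b assume "(a, b) \<in> pi_rel n F"
  then have "equivclp (\<lambda>a b. \<exists>i<n. a \<in> face_verts (F i) \<and> b \<in> face_verts (F i)) a b"
    by (simp add: pi_rel_def)
  then show "(a, b) \<in> r"
  proof (induction rule: equivclp_induct)
    case base
    then show ?case using assms(1) by (simp add: equiv_def refl_on_def)
  next
    case (step y z)
    then have "(y, z) \<in> r" using assms(2) by blast
    then show ?case using step.IH assms(1) by (meson equivE transE)
  qed
qed

lemma equiv_q_rel: "equiv UNIV (q_rel n lam F)"
  by (rule equivI) (auto simp: q_rel_def intro!: refl_onI symI transI)

lemma equiv_ones_rel: "equiv UNIV ones_rel"
proof (intro equivI refl_onI symI transI)
  fix x y z :: "real ^ 'a"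
  show "(x, x) \<in> ones_rel"
    by (auto simp: ones_rel_def vec_eq_iff intro!: exI[of _ 0])
  show "(y, x) \<in> ones_rel" if "(x, y) \<in> ones_rel"
  proof -
    from that obtain c where "y = x + (\<chi> a. c)" by (auto simp: ones_rel_def)
    then have "x = y + (\<chi> a. - c)" by (simp add: vec_eq_iff)
    then show ?thesis by (auto simp: ones_rel_def)
  qed
  show "(x, z) \<in> ones_rel" if "(x, y) \<in> ones_rel" "(y, z) \<in> ones_rel"
  proof -
    from that obtain c c' where "y = x + (\<chi> a. c)" "z = y + (\<chi> a. c')"
      by (auto simp: ones_rel_def)
    then have "z = x + (\<chi> a. c + c')" by (simp add: vec_eq_iff)
    then show ?thesis by (auto simp: ones_rel_def)
  qed
qed auto

end

theory Submission
  imports Defs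
begin

text \<open>
  A functional \<open>w\<close> is maximal on \<open>F\<close> over \<open>P\<close> iff, for every \<open>i\<close>, each vertex of \<open>F\<^sub>i\<close>
  maximizes \<open>w\<close> over \<open>\<lambda>\<^sub>i\<close>; these inequalities generate the ones defining the cone \<open>\<sigma>\<^sub>\<Pi>\<close>. Acyclicity
  makes the number of classes reachable from the class of \<open>a\<close> strictly decrease along edges, so
  this number, as a function of \<open>a\<close>, is a functional maximized over \<open>P\<close> exactly on \<open>F\<close>. Finally,
  the functionals constant on \<open>F\<close> are those constant on the classes of \<open>\<sim>\<^sub>\<Pi>\<close>.
\<close>

section \<open>Coordinate simplices\<close>

text \<open>The barycentric weights of a point are its own coordinates, so membership becomes a
  system of linear conditions.\<close>

lemma std_simplex_eq:
  "std_simplex L = {y. (\<forall>j. 0 \<le> y $ j) \<and> (\<forall>j. j \<notin> L \<longrightarrow> y $ j = 0) \<and> (\<Sum>j\<in>UNIV. y $ j) = 1}"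
    (is "_ = ?R")
proof
  have "convex ?R"
  proof (rule convexI)
    fix x y :: "real ^ 'a" and u v :: real
    assume xy: "x \<in> ?R" "y \<in> ?R" and uv: "0 \<le> u" "0 \<le> v" "u + v = 1"
    then show "u *\<^sub>R x + v *\<^sub>R y \<in> ?R"
      by (simp add: sum.distrib flip: sum_distrib_left)
  qed
  moreover have "(\<lambda>j. axis j 1) ` L \<subseteq> ?R"
    by (auto simp: axis_def)
  ultimately show "std_simplex L \<subseteq> ?R"
    unfolding std_simplex_def by (intro hull_minimal)
next
  show "?R \<subseteq> std_simplex L"
  proof
    fix y assume y: "y \<in> ?R"
    then have sL: "(\<Sum>j\<in>L. y $ j) = 1"
      by (simp add: sum.mono_neutral_left[of UNIV L])
    have "(\<Sum>j\<in>L. (y $ j) *\<^sub>R axis j 1) \<in> std_simplex L"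
      unfolding std_simplex_def
      by (rule convex_sum) (use y sL in \<open>auto intro: hull_inc\<close>)
    moreover have "(\<Sum>j\<in>L. (y $ j) *\<^sub>R axis j 1) = y"
      using y by (auto simp: vec_eq_iff axis_def if_distrib sum.delta cong: if_cong)
    ultimately show "y \<in> std_simplex L" by simp
  qed
qed

lemma axis_in_std_simplex: "a \<in> L \<Longrightarrow> axis a 1 \<in> std_simplex L"
  by (simp add: std_simplex_def hull_inc)

lemma std_simplex_mono: "M \<subseteq> L \<Longrightarrow> std_simplex M \<subseteq> std_simplex L"
  unfolding std_simplex_def by (intro hull_mono image_mono)

text \<open>The coordinates of \<open>y\<close> sum to 1, so \<open>c\<close> can be distributed
  over them. If \<open>w\<close> is at most \<open>c\<close> on \<open>L\<close>, all summands are
  nonnegative, and the gap vanishes only when each of them does.\<close>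

lemma std_simplex_gap:
  assumes "y \<in> std_simplex L"
  shows "c - w \<bullet> y = (\<Sum>j\<in>UNIV. (c - w $ j) * y $ j)"
  using assms
  by (simp add: std_simplex_eq inner_vec_def left_diff_distrib sum_subtractf flip: sum_distrib_left)

lemma inner_std_simplex_le:
  assumes "y \<in> std_simplex L" "\<And>j. j \<in> L \<Longrightarrow> w $ j \<le> c"
  shows "w \<bullet> y \<le> c"
proof -
  have "0 \<le> (\<Sum>j\<in>UNIV. (c - w $ j) * y $ j)"
    using assms by (intro sum_nonneg) (metis (mono_tags, lifting) diff_ge_0_iff_ge mem_Collect_eq
        mult_nonneg_nonneg mult_zero_right order_refl std_simplex_eq)
  then show ?thesis
    using std_simplex_gap[OF assms(1), of c w] by simp
qed

lemma inner_std_simplex_eq: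
  assumes "y \<in> std_simplex L" "\<And>j. j \<in> L \<Longrightarrow> w $ j = c"
  shows "w \<bullet> y = c"
proof (rule antisym)
  show "w \<bullet> y \<le> c"
    using assms by (intro inner_std_simplex_le) auto
  have "(- w) \<bullet> y \<le> - c"
    using assms by (intro inner_std_simplex_le) auto
  then show "c \<le> w \<bullet> y" by simp
qed

lemma std_simplex_maximizers:
  assumes "y \<in> std_simplex L" "\<And>j. j \<in> L \<Longrightarrow> w $ j \<le> c" "w \<bullet> y = c"
  shows "y \<in> std_simplex {j \<in> L. w $ j = c}"
proof -
  \<comment> \<open>Outside \<open>L\<close> the factor \<open>c - w $ j\<close> may be negative,
    but there \<open>y $ j\<close> is 0.\<close>
  have "(c - w $ j) * y $ j \<ge> 0" for j
    using assms(1,2) by (cases "j \<in> L") (auto simp: std_simplex_eq)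
  then have "\<forall>j\<in>UNIV. (c - w $ j) * y $ j = 0"
    using std_simplex_gap[OF assms(1), of c w] assms(3)
    by (subst sum_nonneg_eq_0_iff[symmetric]) auto
  then show ?thesis
    using assms(1) by (auto simp: std_simplex_eq)
qed

text \<open>Distinct standard basis vectors are affinely independent, so each generator is an
  extreme point of the hull. Hence the index set can be recovered from the simplex.\<close>

lemma face_verts_std_simplex: "face_verts (std_simplex L) = L"
proof -
  have "(\<lambda>j. axis j (1::real)) ` L \<subseteq> Basis"
    by (auto simp: Basis_vec_def)
  then have "\<not> affine_dependent ((\<lambda>j. axis j (1::real)) ` L)"
    using independent_Basis independent_mono affine_dependent_imp_dependent by blast
  then show ?thesis
    by (auto simp: face_verts_def std_simplex_def axis_eq_axis
        extreme_point_of_convex_hull_affine_independent)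
qed

text \<open>A face of the convex hull of a compact set is the hull of some of the generators;
  \<open>face_verts_std_simplex\<close> then identifies their indices.\<close>

lemma face_of_std_simplex:
  assumes "S face_of std_simplex L"
  shows "S = std_simplex (face_verts S)" "face_verts S \<subseteq> L"
proof -
  have "compact ((\<lambda>j. axis j (1::real)) ` L)"
    by (simp add: finite_imp_compact)
  then obtain S' where "S' \<subseteq> (\<lambda>j. axis j (1::real)) ` L" "S = convex hull S'"
    using assms face_of_convex_hull_subset unfolding std_simplex_def by metis
  then obtain M where "M \<subseteq> L" "S = std_simplex M"
    by (metis std_simplex_def subset_imageE)
  then show "S = std_simplex (face_verts S)" "face_verts S \<subseteq> L"
    by (simp_all add: face_verts_std_simplex)
qed

section \<open>Functionals on Minkowski sums of simplices\<close>

lemma mem_set_sum_iff: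
  fixes S :: "nat \<Rightarrow> 'a::comm_monoid_add set"
  shows "x \<in> (\<Sum>i<n. S i) \<longleftrightarrow> (\<exists>s. x = (\<Sum>i<n. s i) \<and> (\<forall>i<n. s i \<in> S i))"
  by (auto simp: set_sum_alt)

lemma mem_set_sumI:
  fixes S :: "nat \<Rightarrow> 'a::comm_monoid_add set"
  assumes "\<And>i. i < n \<Longrightarrow> s i \<in> S i"
  shows "(\<Sum>i<n. s i) \<in> (\<Sum>i<n. S i)"
  using assms by (auto simp: mem_set_sum_iff)

text \<open>A linear functional is maximized over a Minkowski sum summand by summand. Necessity is
  tested on sums of vertices that differ in one summand only.\<close>

lemma subset_max_face_simplex_sum_iff:
  fixes L M :: "nat \<Rightarrow> 'd::finite set"
  assumes M: "\<And>i. i < n \<Longrightarrow> M i \<noteq> {}" "\<And>i. i < n \<Longrightarrow> M i \<subseteq> L i"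
  shows "(\<Sum>i<n. std_simplex (M i)) \<subseteq> max_face (\<Sum>i<n. std_simplex (L i)) w \<longleftrightarrow>
    (\<forall>i<n. \<forall>a\<in>L i. \<forall>b\<in>M i. w $ a \<le> w $ b)" (is "?F \<subseteq> max_face ?P w \<longleftrightarrow> ?R")
proof
  assume sub: "?F \<subseteq> max_face ?P w"
  show ?R
  proof (intro allI impI ballI)
    fix k a b assume k: "k < n" "a \<in> L k" "b \<in> M k"
    obtain m where m: "\<And>i. i < n \<Longrightarrow> m i \<in> M i"
      by (rule that[of "\<lambda>i. SOME a. a \<in> M i"]) (use M(1) in \<open>simp add: some_in_eq\<close>)
    \<comment> \<open>All summands except the \<open>k\<close>-th stay at the chosen vertices
      \<open>m i\<close>, so they cancel when \<open>p a\<close> is compared with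
      \<open>p b\<close>.\<close>
    define p where "p c = (\<Sum>i<n. axis ((m(k := c)) i) (1::real))" for c
    have "p b \<in> ?F" "p a \<in> ?P"
      unfolding p_def using m subsetD[OF M(2)] k
      by (auto intro!: mem_set_sumI axis_in_std_simplex)
    then have "w \<bullet> p a \<le> w \<bullet> p b"
      using sub by (auto simp: max_face_def)
    moreover have "w \<bullet> p c = w $ c + (\<Sum>i\<in>{..<n}-{k}. w $ m i)" for c
      using k(1) by (simp add: p_def inner_add_right inner_sum_right inner_axis sum.remove[of _ k])
    ultimately show "w $ a \<le> w $ b" by simp
  qed
next
  assume R: ?R
  show "?F \<subseteq> max_face ?P w"
  proof
    fix x assume x: "x \<in> ?F"
    then obtain s where s: "x = (\<Sum>i<n. s i)" "\<And>i. i < n \<Longrightarrow> s i \<in> std_simplex (M i)"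
      unfolding mem_set_sum_iff by blast
    have "w \<bullet> y \<le> w \<bullet> x" if y: "y \<in> ?P" for y
    proof -
      obtain t where t: "y = (\<Sum>i<n. t i)" "\<And>i. i < n \<Longrightarrow> t i \<in> std_simplex (L i)"
        using y unfolding mem_set_sum_iff by blast
      have "w \<bullet> t i \<le> w \<bullet> s i" if i: "i < n" for i
      proof -
        obtain b where b: "b \<in> M i" using M(1) i by blast
        \<comment> \<open>Both indices lie in \<open>M i\<close> and hence in \<open>L i\<close>, so
          the assumed inequality holds in both directions.\<close>
        have "w $ j = w $ b" if "j \<in> M i" for j
          using that R i b subsetD[OF M(2)[OF i]] by (blast intro: antisym)
        then have "w \<bullet> s i = w $ b"
          using s(2)[OF i] by (rule inner_std_simplex_eq[rotated])
        then show ?thesis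
          using inner_std_simplex_le[OF t(2)[OF i], of w "w $ b"] R i b by simp
      qed
      then show ?thesis
        by (auto simp: s(1) t(1) inner_sum_right intro: sum_mono)
    qed
    moreover have "x \<in> ?P"
      using s std_simplex_mono[OF M(2)] by (auto intro!: mem_set_sumI)
    ultimately show "x \<in> max_face ?P w" by (simp add: max_face_def)
  qed
qed

text \<open>By \<open>le\<close> and \<open>less\<close>, the maximum of \<open>w\<close> over
  \<open>L i\<close> is attained exactly on \<open>M i\<close>. Adding these maxima gives the level
  \<open>c\<close> of a hyperplane that supports the large sum and cuts out the small one.\<close>

lemma simplex_sum_face_of:
  fixes L M :: "nat \<Rightarrow> 'd::finite set" and w :: "real ^ 'd"
  assumes M: "\<And>i. i < n \<Longrightarrow> M i \<noteq> {}" "\<And>i. i < n \<Longrightarrow> M i \<subseteq> L i"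
    and le: "\<And>i a b. i < n \<Longrightarrow> a \<in> L i \<Longrightarrow> b \<in> M i \<Longrightarrow> w $ a \<le> w $ b"
    and less: "\<And>i a b. i < n \<Longrightarrow> a \<in> L i - M i \<Longrightarrow> b \<in> M i \<Longrightarrow> w $ a < w $ b"
  shows "(\<Sum>i<n. std_simplex (M i)) face_of (\<Sum>i<n. std_simplex (L i))" (is "?F face_of ?P")
proof -
  obtain m where m: "\<And>i. i < n \<Longrightarrow> m i \<in> M i"
    by (rule that[of "\<lambda>i. SOME a. a \<in> M i"]) (use M(1) in \<open>simp add: some_in_eq\<close>)
  define c where "c = (\<Sum>i<n. w $ m i)"
  have part_le: "w \<bullet> y \<le> w $ m i" if "i < n" "y \<in> std_simplex (L i)" for i y
    using that le m by (intro inner_std_simplex_le[of y "L i"]) auto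
  have part_eq: "w \<bullet> y = w $ m i" if "i < n" "y \<in> std_simplex (M i)" for i y
    using that le m subsetD[OF M(2)] by (intro inner_std_simplex_eq[of y "M i"] antisym) auto
  have "?P \<inter> {x. w \<bullet> x = c} = ?F"
  proof (intro equalityI subsetI)
    fix y assume y: "y \<in> ?P \<inter> {x. w \<bullet> x = c}"
    then have "y \<in> ?P" by blast
    then obtain t where t: "y = (\<Sum>i<n. t i)" "\<And>i. i < n \<Longrightarrow> t i \<in> std_simplex (L i)"
      unfolding mem_set_sum_iff by blast
    \<comment> \<open>Each summand is nonnegative by \<open>part_le\<close>, so every
      \<open>t i\<close> must attain its own maximum.\<close>
    have "(\<Sum>i<n. w $ m i - w \<bullet> t i) = 0"
      using y by (simp add: c_def t(1) inner_sum_right sum_subtractf)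
    then have eq: "w \<bullet> t i = w $ m i" if "i < n" for i
      using that sum_nonneg_eq_0_iff[of "{..<n}" "\<lambda>i. w $ m i - w \<bullet> t i"] part_le t(2) by auto
    have "t i \<in> std_simplex (M i)" if i: "i < n" for i
    proof -
      have "t i \<in> std_simplex {j \<in> L i. w $ j = w $ m i}"
        using i le m t(2) eq by (intro std_simplex_maximizers) auto
      moreover have "{j \<in> L i. w $ j = w $ m i} \<subseteq> M i"
        using less[OF i _ m[OF i]] by force
      ultimately show ?thesis using std_simplex_mono by blast
    qed
    then show "y \<in> ?F" unfolding t(1) by (rule mem_set_sumI)
  next
    fix x assume "x \<in> ?F"
    then obtain s where s: "x = (\<Sum>i<n. s i)" "\<And>i. i < n \<Longrightarrow> s i \<in> std_simplex (M i)"
      unfolding mem_set_sum_iff by blast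
    then have "x \<in> ?P"
      using std_simplex_mono[OF M(2)] by (auto intro!: mem_set_sumI)
    moreover have "w \<bullet> x = c"
      using s by (simp add: c_def inner_sum_right part_eq)
    ultimately show "x \<in> ?P \<inter> {x. w \<bullet> x = c}" by simp
  qed
  moreover have "?P \<inter> {x. w \<bullet> x = c} face_of ?P"
  proof (rule face_of_Int_supporting_hyperplane_le)
    show "convex ?P"
      by (rule convex_set_sum) (simp add: std_simplex_def)
    fix x assume "x \<in> ?P"
    then obtain t where t: "x = (\<Sum>i<n. t i)" "\<And>i. i < n \<Longrightarrow> t i \<in> std_simplex (L i)"
      unfolding mem_set_sum_iff by blast
    then show "w \<bullet> x \<le> c"
      by (auto simp: c_def inner_sum_right intro!: sum_mono part_le)
  qed
  ultimately show ?thesis by simp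
qed

section \<open>Dimension counts\<close>

lemma dim_constant_on_classes:
  fixes r :: "('d::finite \<times> 'd) set"
  assumes r: "equiv UNIV r"
  shows "dim {w :: real ^ 'd. \<forall>(a, b)\<in>r. w $ a = w $ b} = card (UNIV // r)"
proof -
  \<comment> \<open>The indicator vectors of the classes form the basis: disjoint supports make them
    orthogonal, and nonemptiness of the classes makes them nonzero.\<close>
  define ind where "ind C = (\<chi> a. if a \<in> C then 1 else (0::real))" for C :: "'d set"
  let ?B = "ind ` (UNIV // r)" and ?W = "{w :: real ^ 'd. \<forall>(a, b)\<in>r. w $ a = w $ b}"
  have ne: "C \<noteq> {}" if "C \<in> UNIV // r" for C
    using that in_quotient_imp_non_empty[OF r] by blast
  have "inj ind"
    by (rule injI) (auto simp: ind_def vec_eq_iff split: if_splits)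
  then have card: "card ?B = card (UNIV // r)"
    by (meson card_image inj_on_subset subset_UNIV)
  have "orthogonal (ind C) (ind D)" if "C \<in> UNIV // r" "D \<in> UNIV // r" "C \<noteq> D" for C D
  proof -
    have "C \<inter> D = {}" using quotient_disj[OF r] that by blast
    then show ?thesis
      by (auto simp: orthogonal_def inner_vec_def ind_def intro!: sum.neutral)
  qed
  then have "pairwise orthogonal ?B"
    by (auto simp: pairwise_def)
  moreover have "0 \<notin> ?B"
  proof
    assume "0 \<in> ?B"
    then obtain C where C: "C \<in> UNIV // r" "ind C = 0" by auto
    then obtain a where "a \<in> C" using ne by blast
    then have "ind C $ a = 1" by (simp add: ind_def)
    then show False using C by simp
  qed
  ultimately have "independent ?B"
    by (rule pairwise_orthogonal_independent)
  moreover have "?B \<subseteq> ?W"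
  proof clarify
    fix C a b assume "C \<in> UNIV // r" "(a, b) \<in> r"
    then have "a \<in> C \<longleftrightarrow> b \<in> C"
      by (meson in_quotient_imp_closed r equivE symD)
    then show "ind C $ a = ind C $ b" by (simp add: ind_def)
  qed
  moreover have "?W \<subseteq> span ?B"
  proof
    fix w assume w: "w \<in> ?W"
    \<comment> \<open>Since \<open>w\<close> is constant on each class, any representative gives the
      coefficient.\<close>
    define v where "v C = w $ (SOME a. a \<in> C)" for C
    have "w = (\<Sum>C\<in>UNIV // r. v C *\<^sub>R ind C)"
    proof (subst vec_eq_iff, rule allI)
      fix a
      have a: "r `` {a} \<in> UNIV // r" "a \<in> r `` {a}"
        using equiv_class_self[OF r] by (simp_all add: quotientI)
      have other: "a \<notin> C" if "C \<in> UNIV // r" "C \<noteq> r `` {a}" for C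
        using that a quotient_disj[OF r] by blast
      have "(\<Sum>C\<in>UNIV // r. v C *\<^sub>R ind C) $ a = (\<Sum>C\<in>UNIV // r. if C = r `` {a} then v C else 0)"
        unfolding sum_component by (rule sum.cong) (use a other in \<open>auto simp: ind_def\<close>)
      also have "\<dots> = v (r `` {a})"
        using a by simp
      also have "\<dots> = w $ a"
      proof -
        have "(SOME b. b \<in> r `` {a}) \<in> r `` {a}" using a by (intro someI)
        then show ?thesis using w unfolding v_def by auto
      qed
      finally show "w $ a = (\<Sum>C\<in>UNIV // r. v C *\<^sub>R ind C) $ a" by simp
    qed
    moreover have "(\<Sum>C\<in>UNIV // r. v C *\<^sub>R ind C) \<in> span ?B"
      by (intro span_sum span_scale span_base) auto
    ultimately show "w \<in> span ?B" by simp
  qed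
  ultimately show ?thesis
    using dim_unique[OF _ _ _ card] by blast
qed

text \<open>Exchanging \<open>x\<close> and \<open>y\<close> turns the inequalities into equalities,
  so the functionals form the orthogonal complement of the direction space of \<open>S\<close>. The
  inequality form matches \<open>S \<subseteq> max_face S w\<close>.\<close>

lemma aff_dim_eq_codim_constant:
  fixes S :: "'a::euclidean_space set"
  assumes "S \<noteq> {}"
  shows "aff_dim S = int (DIM('a)) - int (dim {w. \<forall>x\<in>S. \<forall>y\<in>S. w \<bullet> x \<le> w \<bullet> y})"
proof -
  obtain p where p: "p \<in> S" using assms by blast
  let ?D = "(+) (- p) ` S"
  have "(\<forall>x\<in>span ?D. orthogonal x w) \<longleftrightarrow> (\<forall>x\<in>S. \<forall>y\<in>S. w \<bullet> x \<le> w \<bullet> y)" for w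
  proof -
    have "(\<forall>x\<in>span ?D. orthogonal x w) \<longleftrightarrow> (\<forall>x\<in>?D. orthogonal x w)"
      by (meson orthogonal_commute orthogonal_to_span span_base)
    also have "\<dots> \<longleftrightarrow> (\<forall>x\<in>S. w \<bullet> x = w \<bullet> p)"
      by (simp add: orthogonal_def inner_commute[of _ w] inner_diff_right)
    also have "\<dots> \<longleftrightarrow> (\<forall>x\<in>S. \<forall>y\<in>S. w \<bullet> x \<le> w \<bullet> y)"
      using p by (metis order_antisym order_refl)
    finally show ?thesis .
  qed
  then have "dim {w. \<forall>x\<in>S. \<forall>y\<in>S. w \<bullet> x \<le> w \<bullet> y} + dim (span ?D) = DIM('a)"
    using dim_subspace_orthogonal_to_vectors[of "span ?D" UNIV] by simp
  then show ?thesis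
    using aff_dim_eq_dim[OF hull_inc[OF p]] by simp
qed

section \<open>The graph and the order\<close>

lemma pi_class_eq_iff: "pi_class n F a = pi_class n F b \<longleftrightarrow> (a, b) \<in> pi_rel n F"
  unfolding pi_class_def using eq_equiv_class_iff[OF equiv_pi_rel] by blast

lemma q_class_eq_iff: "q_class n lam F a = q_class n lam F b \<longleftrightarrow> (a, b) \<in> q_rel n lam F"
  unfolding q_class_def using eq_equiv_class_iff[OF equiv_q_rel] by blast

lemma pi_graph_iff:
  "(pi_class n F b, pi_class n F a) \<in> pi_graph n lam F \<longleftrightarrow>
    (\<exists>i<n. \<exists>b' a'. (b, b') \<in> pi_rel n F \<and> (a, a') \<in> pi_rel n F \<and>
       b' \<in> face_verts (F i) \<and> a' \<in> lam i - face_verts (F i))"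
  by (auto simp: pi_graph_def pi_class_def quotientI)

text \<open>Having equal values under \<open>x\<close> is itself an equivalence relation, so
  minimality of \<open>pi_rel\<close> applies.\<close>

lemma constant_on_pi_rel_iff:
  "(\<forall>(a, b)\<in>pi_rel n F. x a = x b) \<longleftrightarrow>
    (\<forall>i<n. \<forall>a\<in>face_verts (F i). \<forall>b\<in>face_verts (F i). x a = x b)"
proof
  assume "\<forall>(a, b)\<in>pi_rel n F. x a = x b"
  then show "\<forall>i<n. \<forall>a\<in>face_verts (F i). \<forall>b\<in>face_verts (F i). x a = x b"
    using pi_rel_contains by fast
next
  assume "\<forall>i<n. \<forall>a\<in>face_verts (F i). \<forall>b\<in>face_verts (F i). x a = x b"
  moreover have "equiv UNIV {(a, b). x a = x b}"
    by (rule equivI) (auto intro: refl_onI symI transI)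
  ultimately have "pi_rel n F \<subseteq> {(a, b). x a = x b}"
    by (intro pi_rel_least) blast+
  then show "\<forall>(a, b)\<in>pi_rel n F. x a = x b" by blast
qed

text \<open>Each pair on the right is a single generating step of \<open>q_order\<close>: within one
  class if \<open>a\<close> is a vertex of \<open>F i\<close>, along an edge otherwise. Conversely,
  the inequalities pass from edges to paths, then to strongly connected components, then to the
  transitive closure.\<close>

lemma monotone_q_order_iff:
  fixes x :: "real ^ 'd::finite" and F :: "nat \<Rightarrow> (real ^ 'd) set"
  assumes sub: "\<And>i. i < n \<Longrightarrow> face_verts (F i) \<subseteq> lam i"
  shows "(\<forall>a b. (q_class n lam F a, q_class n lam F b) \<in> q_order n lam F \<longrightarrow> x $ a \<le> x $ b) \<longleftrightarrow>
    (\<forall>i<n. \<forall>a\<in>lam i. \<forall>b\<in>face_verts (F i). x $ a \<le> x $ b)" (is "?L \<longleftrightarrow> ?R")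
proof
  assume L: ?L
  have "(q_class n lam F a, q_class n lam F b) \<in> q_order n lam F"
    if "i < n" "a \<in> lam i" "b \<in> face_verts (F i)" for i a b
  proof -
    have "pi_class n F a = pi_class n F b \<or> (pi_class n F b, pi_class n F a) \<in> pi_graph n lam F"
    proof (cases "a \<in> face_verts (F i)")
      case True
      then show ?thesis
        using that by (auto simp: pi_class_eq_iff intro: pi_rel_contains)
    next
      case False
      have "(c, c) \<in> pi_rel n F" for c
        using pi_class_eq_iff by blast
      then show ?thesis
        using False that unfolding pi_graph_iff by blast
    qed
    then show ?thesis
      unfolding q_order_def by (intro r_into_trancl) blast
  qed
  then show ?R using L by blast
next
  assume R: ?R
  then have "\<forall>i<n. \<forall>a\<in>face_verts (F i). \<forall>b\<in>face_verts (F i). x $ a = x $ b"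
    using sub by (meson order_antisym subsetD)
  then have const: "x $ a = x $ b" if "(a, b) \<in> pi_rel n F" for a b
    using that constant_on_pi_rel_iff[of n F "\<lambda>a. x $ a"] by blast
  have edge: "x $ a \<le> x $ b" if "(pi_class n F b, pi_class n F a) \<in> pi_graph n lam F" for a b
    using that R const unfolding pi_graph_iff by (metis DiffD1)
  \<comment> \<open>The endpoint is a separate variable \<open>A\<close>, so that the induction runs
    over classes while its claim covers every representative \<open>a\<close>.\<close>
  have path: "x $ a \<le> x $ b" if "(pi_class n F b, A) \<in> (pi_graph n lam F)\<^sup>*" "A = pi_class n F a"
    for a b A
    using that
  proof (induction arbitrary: a rule: rtrancl_induct)
    case base
    then show ?case by (metis const order_refl pi_class_eq_iff)
  next
    case (step C A)
    then have "C \<in> UNIV // pi_rel n F" by (auto simp: pi_graph_def)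
    then obtain c where c: "C = pi_class n F c"
      by (auto simp: pi_class_def elim: quotientE)
    have "x $ a \<le> x $ c" using step.hyps(2) step.prems c by (intro edge) simp
    also have "\<dots> \<le> x $ b" using c by (rule step.IH)
    finally show ?case .
  qed
  \<comment> \<open>Paths in both directions give both inequalities, so \<open>x\<close> is well
    defined on the strongly connected components.\<close>
  have q: "x $ a = x $ b" if "q_class n lam F a = q_class n lam F b" for a b
    using that path unfolding q_class_eq_iff q_rel_def by (blast intro: antisym)
  have "x $ a \<le> x $ b" if "(A, B) \<in> q_order n lam F" "A = q_class n lam F a" "B = q_class n lam F b"
    for A B a b
    using that unfolding q_order_def
  proof (induction arbitrary: b rule: trancl_induct)
    case (base B)
    \<comment> \<open>The representatives witnessing a generating step may differ from the given
      \<open>a\<close> and \<open>b\<close>; the fact \<open>q\<close> transfers the values between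
      them.\<close>
    then obtain a' b' where "A = q_class n lam F a'" "B = q_class n lam F b'"
      "pi_class n F a' = pi_class n F b' \<or> (pi_class n F b', pi_class n F a') \<in> pi_graph n lam F"
      by blast
    moreover from this have "x $ a' \<le> x $ b'"
      using edge const by (metis order_refl pi_class_eq_iff)
    moreover have "x $ a = x $ a'" "x $ b' = x $ b"
      using calculation base.prems by (auto intro: q)
    ultimately show ?case by simp
  next
    case (step C B)
    then obtain c b' where "C = q_class n lam F c" "B = q_class n lam F b'"
      "pi_class n F c = pi_class n F b' \<or> (pi_class n F b', pi_class n F c) \<in> pi_graph n lam F"
      by blast
    moreover from this have "x $ c \<le> x $ b'"
      using edge const by (metis order_refl pi_class_eq_iff)
    moreover have "x $ b' = x $ b"
      using calculation step.prems q by metis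
    ultimately show ?case
      using step by (metis order_trans)
  qed
  then show ?L by blast
qed

text \<open>Everything reachable from \<open>y\<close> is reachable from \<open>x\<close>. The
  inclusion is proper because \<open>y\<close> itself is reachable from \<open>x\<close>, but not
  from \<open>y\<close> in an acyclic relation.\<close>

lemma acyclic_card_reachable_less:
  assumes "acyclic r" "finite r" "(x, y) \<in> r"
  shows "card (r\<^sup>+ `` {y}) < card (r\<^sup>+ `` {x})"
proof (rule psubset_card_mono)
  show "finite (r\<^sup>+ `` {x})"
    using assms(2) by simp
  have "y \<in> r\<^sup>+ `` {x}" "y \<notin> r\<^sup>+ `` {y}"
    using assms by (auto simp: acyclic_def)
  moreover have "r\<^sup>+ `` {y} \<subseteq> r\<^sup>+ `` {x}"
    using assms(3) by (auto intro: trancl_into_trancl2)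
  ultimately show "r\<^sup>+ `` {y} \<subset> r\<^sup>+ `` {x}" by blast
qed

theorem lemma3p7:
  fixes n :: nat
    and lam :: "nat \<Rightarrow> 'd::finite set"
    and F :: "nat \<Rightarrow> (real ^ 'd) set"
  assumes lam_nonempty: "\<And>i. i < n \<Longrightarrow> lam i \<noteq> {}"
    and F_face: "\<And>i. i < n \<Longrightarrow> F i face_of std_simplex (lam i)"
    and F_nonempty: "\<And>i. i < n \<Longrightarrow> F i \<noteq> {}"
    and acyclic_graph: "acyclic (pi_graph n lam F)"
  shows "(\<Sum>i<n. F i) face_of (\<Sum>i<n. std_simplex (lam i)) \<and>
         outer_normal_cone (\<Sum>i<n. std_simplex (lam i)) (\<Sum>i<n. F i) = sigma_cone n lam F \<and>
         aff_dim (\<Sum>i<n. F i) = int (CARD('d)) - int (card (UNIV // pi_rel n F))"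
proof -
  define M where "M i = face_verts (F i)" for i
  have FM: "F i = std_simplex (M i)" and sub: "M i \<subseteq> lam i" if "i < n" for i
    using face_of_std_simplex[OF F_face[OF that]] by (simp_all add: M_def)
  have ne: "M i \<noteq> {}" if "i < n" for i
    using F_nonempty[OF that] FM[OF that] by (auto simp: std_simplex_def)
  have sumF: "(\<Sum>i<n. F i) = (\<Sum>i<n. std_simplex (M i))"
    by (rule sum.cong) (simp_all add: FM)
  \<comment> \<open>Edges run from classes meeting the vertices of \<open>F i\<close> to classes
    meeting the rest of \<open>lam i\<close>, so this count is larger on the vertices of
    \<open>F i\<close>, as an outer normal requires.\<close>
  define w :: "real ^ 'd"
    where "w = (\<chi> a. real (card ((pi_graph n lam F)\<^sup>+ `` {pi_class n F a})))"
  have less: "w $ a < w $ b" if "i < n" "a \<in> lam i - M i" "b \<in> M i" for i a b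
  proof -
    have "(c, c) \<in> pi_rel n F" for c
      using pi_class_eq_iff by blast
    then have "(pi_class n F b, pi_class n F a) \<in> pi_graph n lam F"
      using that unfolding pi_graph_iff M_def by blast
    then show ?thesis
      using acyclic_graph by (simp add: w_def acyclic_card_reachable_less)
  qed
  have "w $ a = w $ b" if "i < n" "a \<in> M i" "b \<in> M i" for i a b
  proof -
    have "pi_class n F a = pi_class n F b"
      using that by (auto simp: pi_class_eq_iff M_def intro: pi_rel_contains)
    then show ?thesis by (simp add: w_def)
  qed
  then have le: "w $ a \<le> w $ b" if "i < n" "a \<in> lam i" "b \<in> M i" for i a b
    using that less by (metis DiffI order_less_imp_le order_refl)
  have "(\<Sum>i<n. F i) face_of (\<Sum>i<n. std_simplex (lam i))"
    unfolding sumF using ne sub le less by (rule simplex_sum_face_of)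
  \<comment> \<open>Both cones are quotients by \<open>ones_rel\<close>, so it suffices that the
    sets upstairs agree; each is described by the same inequalities between \<open>lam i\<close> and
    \<open>M i\<close>.\<close>
  moreover have "outer_normal_cone (\<Sum>i<n. std_simplex (lam i)) (\<Sum>i<n. F i) = sigma_cone n lam F"
    unfolding outer_normal_cone_def sigma_cone_def sumF
    using subset_max_face_simplex_sum_iff[of n M lam, OF ne sub] monotone_q_order_iff[of n F lam] sub
    by (simp add: M_def)
  moreover have "aff_dim (\<Sum>i<n. F i) = int (CARD('d)) - int (card (UNIV // pi_rel n F))"
  proof -
    have "(\<Sum>i<n. F i) \<noteq> {}"
      using mem_set_sumI[of n "\<lambda>i. SOME x. x \<in> F i" F] F_nonempty by (auto simp: some_in_eq)
    moreover have "{w. \<forall>x\<in>\<Sum>i<n. F i. \<forall>y\<in>\<Sum>i<n. F i. w \<bullet> x \<le> w \<bullet> y} =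
        {w. \<forall>(a, b)\<in>pi_rel n F. w $ a = w $ b}"
    proof (rule Collect_cong)
      fix w :: "real ^ 'd"
      have "(\<forall>x\<in>\<Sum>i<n. F i. \<forall>y\<in>\<Sum>i<n. F i. w \<bullet> x \<le> w \<bullet> y) \<longleftrightarrow>
          (\<Sum>i<n. F i) \<subseteq> max_face (\<Sum>i<n. F i) w"
        by (auto simp: max_face_def)
      \<comment> \<open>The criterion is used with \<open>M\<close> as both families: a functional
        is constant on the sum exactly when the whole sum is its own set of maximizers.\<close>
      also have "\<dots> \<longleftrightarrow> (\<forall>i<n. \<forall>a\<in>M i. \<forall>b\<in>M i. w $ a \<le> w $ b)"
        unfolding sumF by (rule subset_max_face_simplex_sum_iff) (simp_all add: ne)
      also have "\<dots> \<longleftrightarrow> (\<forall>i<n. \<forall>a\<in>M i. \<forall>b\<in>M i. w $ a = w $ b)"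
        by (auto simp: order.eq_iff)
      also have "\<dots> \<longleftrightarrow> (\<forall>(a, b)\<in>pi_rel n F. w $ a = w $ b)"
        using constant_on_pi_rel_iff[of n F "\<lambda>a. w $ a"] by (simp add: M_def)
      finally show "(\<forall>x\<in>\<Sum>i<n. F i. \<forall>y\<in>\<Sum>i<n. F i. w \<bullet> x \<le> w \<bullet> y) \<longleftrightarrow>
          (\<forall>(a, b)\<in>pi_rel n F. w $ a = w $ b)" .
    qed
    ultimately show ?thesis
      by (simp add: aff_dim_eq_codim_constant dim_constant_on_classes[OF equiv_pi_rel])
  qed
  ultimately show ?thesis by blast
qed

end
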